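(* Consider the finite-difference scheme on the infinite mesh $$C_\theta[\rho_h]\,\bar\partial_tU^m+\mathcal A_hU^{(\sigma)\,m}=F^m\ \text{ on }\omega_{h,\infty},\ m\ge1;\qquad U_0^m=0,\ m\ge1;\qquad U^0=U_h^0\ \text{ on }\bar\omega_{h,\infty}.$$ Let $F=F^{(0)}+\widehat\partial_xF^{(1)}$ with $F^{(0)\,m}\in H_h$ for any $m\ge1$ and $F^{(1)\,m}\in\widetilde H_h$ for any $m\ge0$, and let $U_h^0\in H_h$. Then, for $\sigma\ge\frac12$ and $\theta<\frac14$, the bound $$\max\Bigl\{\max_{0\le m\le M}\|U^m\|_{\mathcal L_{H_{h\theta}}},\ \sqrt2\,\|U\|_{(2),\infty}\Bigr\}\le\|U_h^0\|_{\mathcal L_{H_{h\theta}}}+\sqrt{\frac{2}{c_\theta\underline\rho}}\Bigl(\sum_{m=1}^M\|F^{(0)\,m}\|_{H_h}^2\tau_m\Bigr)^{1/2}+\frac{4}{\sqrt\nu}\Bigl(\|F^{(1)\,0}\|_{\widetilde H_h}+\sum_{m=1}^M\|\bar\partial_tF^{(1)\,m}\|_{\widetilde H_h}\tau_m\Bigr)$$ holds for the solution with $U^m\in H_h$, for all $m\ge0$, and any $M\ge1$, where $c_\theta=1-4\max\{\theta,0\}$ and $$\|U\|_{(2),\infty}^2=\sum_{m=1}^M(\sigma-\tfrac12)\tau_m\|\bar\partial_tU^m\|^2_{\mathcal L_{H_{h\theta}}}\tau_m+\sum_{m=1}^M\|\bar\partial_tU^m\|^2_{C_\theta[\rho_h],\infty}\tau_m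 .$$ The bound holds also for $\theta=\frac14$ provided that $F^{(0)}=0$ (the summand with $F^{(0)}$ being dropped).
   Context: All mesh functions are real-valued; $\sigma,\theta$ are real parameters. Coefficients: $\rho,b,c$ are continuous with $\rho(x)\ge\underline\rho>0$, $b(x)\ge\nu>0$, $c(x)\ge 0$ for $x>0$, and for some $X_0>0$: $\rho(x)=\rho_\infty>0$, $b(x)=b_\infty>0$, $c(x)=c_\infty\ge0$ for $x\ge X_0$. Fix $X>X_0$. Meshes: $\bar\omega_{h,\infty}$ has nodes $0=x_0<x_1<\dots<x_J=X<\dots$ with steps $h_j=x_j-x_{j-1}$, $h_J\le X-X_0$, $h_j=h:=h_J$ for $j\ge J$; $x_{j-1/2}=\frac{x_{j-1}+x_j}2$, $h_{j+1/2}=\frac{h_j+h_{j+1}}2$; $\omega_{h,\infty}=\bar\omega_{h,\infty}\setminus\{0\}$. In time: $0=t_0<t_1<\dots$, $t_m\to\infty$, $\tau_m=t_m-t_{m-1}$. Mesh coefficients: $\rho_{hj}=\rho(x_{j-1/2})$, $b_{hj}=b(x_{j-1/2})$, $c_{hj}=c(x_{j-1/2})$, $j\ge1$. The equation and the decomposition of $F$ are for $m\ge 1$; $F^{(1)\,0}\in\widetilde H_h$ does not enter the scheme and is arbitrary. Operators: $\bar\partial_xW_j=\frac{W_j-W_{j-1}}{h_j}$, $\widehat\partial_xW_j=\frac{W_{j+1}-W_j}{h_{j+1/2}}$, $\widehat s_xW_j=\frac{h_j}{2h_{j+1/2}}W_j+\frac{h_{j+1}}{2h_{j+1/2}}W_{j+1}$,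 $$C_\theta[\varkappa_h]W_j=\theta\tfrac{h_j}{h_{j+1/2}}\varkappa_{hj}W_{j-1}+(1-2\theta)(\widehat s_x\varkappa_{hj})W_j+\theta\tfrac{h_{j+1}}{h_{j+1/2}}\varkappa_{h,j+1}W_{j+1},$$ $\mathcal A_hW=-\widehat\partial_x(b_h\bar\partial_xW)+C_\theta[c_h]W$. In time: $\bar\partial_t\Phi^m=\frac{\Phi^m-\Phi^{m-1}}{\tau_m}$, $\Phi^{(\sigma)\,m}=\sigma\Phi^m+(1-\sigma)\Phi^{m-1}$. Spaces: $H_h$ is the Hilbert space of functions $W$ on $\bar\omega_{h,\infty}$ with $W_0=0$ and $\sum_{j\ge1}W_j^2<\infty$, with inner product $(V,W)_{H_h}=\sum_{j=1}^\infty V_jW_jh_{j+1/2}$; $\widetilde H_h$ is the Hilbert space of functions $W$ on $\omega_{h,\infty}$ with $\sum_{j\ge1}W_j^2<\infty$, with inner product $(V,W)_{\widetilde H_h}=\sum_{j=1}^\infty V_jW_jh_j$. Norms: for $\theta\le\frac14$, $W\in H_h$: $\|W\|_{C_\theta[\rho_h],\infty}=(C_\theta[\rho_h]W,W)_{H_h}^{1/2}$, and $\|W\|_{\mathcal L_{H_{h\theta}}}=\mathcal L_{H_{h\theta}}^{1/2}(W,W)$ with $\mathcal L_{H_{h\theta}}(V,W)=(b_h\bar\partial_xV,\bar\partial_xW)_{\widetilde H_h}+(C_\theta[c_h]V,W)_{H_h}$. *)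

theory Defs
  imports "HOL-Analysis.Analysis"
begin

text \<open>
  A mesh function is a function \<open>nat \<Rightarrow> real\<close> of the node number \<open>j\<close>. Functions on the mesh with
  the node \<open>x 0 = 0\<close> removed (mesh coefficients, difference quotients, the elements of \<open>Htilde\<close>,
  both sides of the scheme) are only meaningful for \<open>j \<ge> 1\<close>; their value at \<open>j = 0\<close> is junk and is
  never used. Sums over \<open>j \<ge> 1\<close> are written as \<open>\<Sum>j. f (Suc j)\<close>.
\<close>

definition step :: "(nat \<Rightarrow> real) \<Rightarrow> nat \<Rightarrow> real" where
  "step x j = x j - x (j - 1)"

text \<open>\<open>hstep x j\<close> is the averaged step with index \<open>j + 1/2\<close>.\<close>

definition hstep :: "(nat \<Rightarrow> real) \<Rightarrow> nat \<Rightarrow> real" where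
  "hstep x j = (step x j + step x (j + 1)) / 2"

definition mesh_coeff :: "(nat \<Rightarrow> real) \<Rightarrow> (real \<Rightarrow> real) \<Rightarrow> nat \<Rightarrow> real" where
  "mesh_coeff x \<kappa> j = \<kappa> ((x (j - 1) + x j) / 2)"

definition bdx :: "(nat \<Rightarrow> real) \<Rightarrow> (nat \<Rightarrow> real) \<Rightarrow> nat \<Rightarrow> real" where
  "bdx x W j = (W j - W (j - 1)) / step x j"

definition hdx :: "(nat \<Rightarrow> real) \<Rightarrow> (nat \<Rightarrow> real) \<Rightarrow> nat \<Rightarrow> real" where
  "hdx x W j = (W (j + 1) - W j) / hstep x j"

definition hsx :: "(nat \<Rightarrow> real) \<Rightarrow> (nat \<Rightarrow> real) \<Rightarrow> nat \<Rightarrow> real" where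
  "hsx x W j = step x j / (2 * hstep x j) * W j + step x (j + 1) / (2 * hstep x j) * W (j + 1)"

definition C_op :: "(nat \<Rightarrow> real) \<Rightarrow> real \<Rightarrow> (nat \<Rightarrow> real) \<Rightarrow> (nat \<Rightarrow> real) \<Rightarrow> nat \<Rightarrow> real" where
  "C_op x \<theta> \<kappa> W j =
     \<theta> * (step x j / hstep x j) * \<kappa> j * W (j - 1)
     + (1 - 2 * \<theta>) * hsx x \<kappa> j * W j
     + \<theta> * (step x (j + 1) / hstep x j) * \<kappa> (j + 1) * W (j + 1)"

definition A_op ::
  "(nat \<Rightarrow> real) \<Rightarrow> real \<Rightarrow> (nat \<Rightarrow> real) \<Rightarrow> (nat \<Rightarrow> real) \<Rightarrow> (nat \<Rightarrow> real) \<Rightarrow> nat \<Rightarrow> real" where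
  "A_op x \<theta> bh ch W j = - hdx x (\<lambda>i. bh i * bdx x W i) j + C_op x \<theta> ch W j"

definition bdt :: "(nat \<Rightarrow> real) \<Rightarrow> (nat \<Rightarrow> nat \<Rightarrow> real) \<Rightarrow> nat \<Rightarrow> nat \<Rightarrow> real" where
  "bdt t \<Phi> m j = (\<Phi> m j - \<Phi> (m - 1) j) / step t m"

definition t_weighted :: "real \<Rightarrow> (nat \<Rightarrow> nat \<Rightarrow> real) \<Rightarrow> nat \<Rightarrow> nat \<Rightarrow> real" where
  "t_weighted \<sigma> \<Phi> m j = \<sigma> * \<Phi> m j + (1 - \<sigma>) * \<Phi> (m - 1) j"

definition Hh :: "(nat \<Rightarrow> real) set" where
  "Hh = {W. W 0 = 0 \<and> summable (\<lambda>j. (W (Suc j))\<^sup>2)}"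

definition Htilde :: "(nat \<Rightarrow> real) set" where
  "Htilde = {W. summable (\<lambda>j. (W (Suc j))\<^sup>2)}"

definition Hh_inner :: "(nat \<Rightarrow> real) \<Rightarrow> (nat \<Rightarrow> real) \<Rightarrow> (nat \<Rightarrow> real) \<Rightarrow> real" where
  "Hh_inner x V W = (\<Sum>j. V (Suc j) * W (Suc j) * hstep x (Suc j))"

definition Htilde_inner :: "(nat \<Rightarrow> real) \<Rightarrow> (nat \<Rightarrow> real) \<Rightarrow> (nat \<Rightarrow> real) \<Rightarrow> real" where
  "Htilde_inner x V W = (\<Sum>j. V (Suc j) * W (Suc j) * step x (Suc j))"

definition Hh_norm :: "(nat \<Rightarrow> real) \<Rightarrow> (nat \<Rightarrow> real) \<Rightarrow> real" where
  "Hh_norm x W = sqrt (Hh_inner x W W)"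

definition Htilde_norm :: "(nat \<Rightarrow> real) \<Rightarrow> (nat \<Rightarrow> real) \<Rightarrow> real" where
  "Htilde_norm x W = sqrt (Htilde_inner x W W)"

definition C_norm :: "(nat \<Rightarrow> real) \<Rightarrow> real \<Rightarrow> (nat \<Rightarrow> real) \<Rightarrow> (nat \<Rightarrow> real) \<Rightarrow> real" where
  "C_norm x \<theta> \<rho>h W = sqrt (Hh_inner x (C_op x \<theta> \<rho>h W) W)"

definition L_form ::
  "(nat \<Rightarrow> real) \<Rightarrow> real \<Rightarrow> (nat \<Rightarrow> real) \<Rightarrow> (nat \<Rightarrow> real) \<Rightarrow> (nat \<Rightarrow> real) \<Rightarrow> (nat \<Rightarrow> real) \<Rightarrow> real" where
  "L_form x \<theta> bh ch V W =
     Htilde_inner x (\<lambda>j. bh j * bdx x V j) (bdx x W) + Hh_inner x (C_op x \<theta> ch V) W"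

definition L_norm ::
  "(nat \<Rightarrow> real) \<Rightarrow> real \<Rightarrow> (nat \<Rightarrow> real) \<Rightarrow> (nat \<Rightarrow> real) \<Rightarrow> (nat \<Rightarrow> real) \<Rightarrow> real" where
  "L_norm x \<theta> bh ch W = sqrt (L_form x \<theta> bh ch W W)"

text \<open>The norm with subscript \<open>(2), \<infinity>\<close> over the time levels \<open>1, \<dots>, M\<close>.\<close>

definition norm2 ::
  "(nat \<Rightarrow> real) \<Rightarrow> (nat \<Rightarrow> real) \<Rightarrow> real \<Rightarrow> real \<Rightarrow> (nat \<Rightarrow> real) \<Rightarrow> (nat \<Rightarrow> real) \<Rightarrow> (nat \<Rightarrow> real)
     \<Rightarrow> nat \<Rightarrow> (nat \<Rightarrow> nat \<Rightarrow> real) \<Rightarrow> real" where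
  "norm2 x t \<sigma> \<theta> \<rho>h bh ch M U = sqrt (
     (\<Sum>m=1..M. (\<sigma> - 1/2) * step t m * (L_norm x \<theta> bh ch (bdt t U m))\<^sup>2 * step t m)
     + (\<Sum>m=1..M. (C_norm x \<theta> \<rho>h (bdt t U m))\<^sup>2 * step t m))"

definition scheme_solution ::
  "(nat \<Rightarrow> real) \<Rightarrow> (nat \<Rightarrow> real) \<Rightarrow> real \<Rightarrow> real \<Rightarrow> (nat \<Rightarrow> real) \<Rightarrow> (nat \<Rightarrow> real) \<Rightarrow> (nat \<Rightarrow> real)
     \<Rightarrow> (nat \<Rightarrow> nat \<Rightarrow> real) \<Rightarrow> (nat \<Rightarrow> real) \<Rightarrow> (nat \<Rightarrow> nat \<Rightarrow> real) \<Rightarrow> bool" where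
  "scheme_solution x t \<sigma> \<theta> \<rho>h bh ch F Uh0 U \<longleftrightarrow>
     (\<forall>m\<ge>1. \<forall>j\<ge>1. C_op x \<theta> \<rho>h (bdt t U m) j + A_op x \<theta> bh ch (t_weighted \<sigma> U m) j = F m j)
     \<and> (\<forall>m\<ge>1. U m 0 = 0)
     \<and> (\<forall>j. U 0 j = Uh0 j)"

definition c_theta :: "real \<Rightarrow> real" where
  "c_theta \<theta> = 1 - 4 * max \<theta> 0"

end

theory Submission
  imports Defs
begin

text \<open>
  The bound is an energy estimate. On a mesh cell of length \<open>h\<close> with end values \<open>u\<close>, \<open>v\<close>, both
  \<open>(C_op x \<theta> \<kappa> W, W)\<close> and the form \<open>L_form\<close> reduce to explicit symmetric quadratic forms of \<open>u\<close> and
  \<open>v\<close> (\<open>C_form_sums\<close>, \<open>L_form_sums\<close>); the boundary terms vanish because \<open>W 0 = 0\<close>. The cell form of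
  \<open>C_op\<close> has eigenvalues \<open>1/2\<close> and \<open>(1 - 4 * \<theta>) / 2\<close> (times \<open>h\<close> and the coefficient), which explains the
  threshold \<open>\<theta> = 1/4\<close> and the constant \<open>c_theta\<close> (\<open>C_form_coercive\<close>).

  Write \<open>|W|\<close> for the norm \<open>L_norm\<close> and \<open>D\<close> for the difference quotient \<open>bdt t U m\<close>. The equation is
  multiplied by \<open>D\<close> in \<open>Hh\<close>. Its first term contributes the square of \<open>C_norm\<close> of \<open>D\<close>. Since the
  weighted value equals \<open>(U m + U (m - 1)) / 2\<close> plus \<open>(\<sigma> - 1/2)\<close> times the time step times \<open>D\<close>, the
  second term yields half the increment of \<open>|U m|^2\<close> and \<open>|D|^2\<close> with a factor that is nonnegative for
  \<open>\<sigma> \<ge> 1/2\<close> (\<open>energy_step\<close>). Summation over the time levels gives, with \<open>z n\<close> equal to \<open>sqrt 2\<close> times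
  \<open>norm2\<close> over the first \<open>n\<close> levels,
  \<open>|U n|^2 + (z n)^2 = |U 0|^2 + 2 * (sum of (F0, D)) - 2 * (sum of (F1, bdx D))\<close>, each sum
  weighted by the time steps (\<open>energy_balance\<close>). The first sum is at most a constant times \<open>z n\<close>, by
  coercivity and the Cauchy--Schwarz inequality (\<open>source_estimate\<close>). In the second sum the left-hand
  side offers no control of \<open>bdx D\<close> that is uniform in the time steps and in \<open>\<sigma>\<close>; Abel summation
  moves the time difference to \<open>F1\<close>,
  and what remains is at most a constant times the maximum of \<open>|U m|\<close> (\<open>flux_estimate\<close>).

  Let \<open>Y\<close> be the maximum of all \<open>|U m|\<close> and \<open>z M\<close>. If \<open>Y\<close> is some \<open>|U n|\<close>, the balance at level
  \<open>n\<close> is used; if \<open>Y = z M\<close>, the balance at level \<open>M\<close>. Either way \<open>Y^2 \<le> |U 0|^2 + (a + g) * Y\<close>, where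
  \<open>a\<close> and \<open>g\<close> are the two data terms, and \<open>|U 0| \<le> Y\<close> gives \<open>Y \<le> |U 0| + a + g\<close>
  (\<open>energy_bound\<close>).
\<close>

section \<open>Square-summable sequences\<close>

lemma summable_bounded_mult:
  fixes f g k :: "nat \<Rightarrow> real"
  assumes "summable (\<lambda>j. (f j)\<^sup>2)" "summable (\<lambda>j. (g j)\<^sup>2)" "Bseq k"
  shows "summable (\<lambda>j. k j * (f j * g j))"
proof -
  obtain B where B: "B > 0" "\<And>n. \<bar>k n\<bar> \<le> B"
    using assms(3) by (auto elim!: BseqE)
  have s: "summable (\<lambda>j. B * ((f j)\<^sup>2 + (g j)\<^sup>2))"
    by (intro summable_mult summable_add assms)
  show ?thesis
  proof (rule summable_comparison_test'[OF s])
    fix n :: nat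
    have "0 \<le> (\<bar>f n\<bar> - \<bar>g n\<bar>)\<^sup>2" "0 \<le> (f n)\<^sup>2" "0 \<le> (g n)\<^sup>2" by simp_all
    then have "\<bar>f n\<bar> * \<bar>g n\<bar> \<le> (f n)\<^sup>2 + (g n)\<^sup>2"
      unfolding power2_diff power2_abs by linarith
    then show "norm (k n * (f n * g n)) \<le> B * ((f n)\<^sup>2 + (g n)\<^sup>2)"
      using B by (auto simp: abs_mult intro!: mult_mono)
  qed
qed

lemma summable_square_linear:
  fixes f g :: "nat \<Rightarrow> real"
  assumes "summable (\<lambda>j. (f j)\<^sup>2)" "summable (\<lambda>j. (g j)\<^sup>2)"
  shows "summable (\<lambda>j. (p * f j + q * g j)\<^sup>2)"
proof -
  have "summable (\<lambda>j. (f j)\<^sup>2 * p\<^sup>2 + 2 * p * q * (f j * g j) + (g j)\<^sup>2 * q\<^sup>2)"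
    by (intro summable_add summable_mult2 assms summable_bounded_mult)
      (auto intro: convergent_imp_Bseq)
  then show ?thesis
    by (simp add: power2_eq_square algebra_simps)
qed

lemma Hh_linear:
  assumes "V \<in> Hh" "W \<in> Hh"
  shows "(\<lambda>j. p * V j + q * W j) \<in> Hh"
  using assms summable_square_linear[of "\<lambda>j. V (Suc j)" "\<lambda>j. W (Suc j)"]
  by (simp add: Hh_def)

lemma Htilde_linear:
  assumes "V \<in> Htilde" "W \<in> Htilde"
  shows "(\<lambda>j. p * V j + q * W j) \<in> Htilde"
  using assms summable_square_linear[of "\<lambda>j. V (Suc j)" "\<lambda>j. W (Suc j)"]
  by (simp add: Htilde_def)

lemma bounded_mult_Htilde:
  assumes "Bseq k" "V \<in> Htilde" shows "(\<lambda>j. k j * V j) \<in> Htilde"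
proof -
  obtain B where B: "B > 0" "\<And>n. \<bar>k n\<bar> \<le> B"
    using assms(1) by (auto elim!: BseqE)
  have s: "summable (\<lambda>j. B\<^sup>2 * (V (Suc j))\<^sup>2)"
    using assms(2) by (intro summable_mult) (simp add: Htilde_def)
  have "summable (\<lambda>j. (k (Suc j) * V (Suc j))\<^sup>2)"
  proof (rule summable_comparison_test'[OF s])
    fix n :: nat
    have "(k (Suc n))\<^sup>2 \<le> B\<^sup>2"
      using B by (metis abs_ge_zero power2_abs power_mono)
    then show "norm ((k (Suc n) * V (Suc n))\<^sup>2) \<le> B\<^sup>2 * (V (Suc n))\<^sup>2"
      by (simp add: power_mult_distrib mult_right_mono)
  qed
  then show ?thesis by (simp add: Htilde_def)
qed

lemma Hh_square_summable:
  assumes "V \<in> Hh"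
  shows "summable (\<lambda>j. (V (Suc j))\<^sup>2)" "summable (\<lambda>j. (V j)\<^sup>2)" "V 0 = 0"
  using assms summable_Suc_iff[of "\<lambda>j. (V j)\<^sup>2"] by (simp_all add: Hh_def)

lemma bdt_alt: "bdt t \<Phi> m = (\<lambda>j. (1 / step t m) * \<Phi> m j + (- 1 / step t m) * \<Phi> (m - 1) j)"
  by (simp add: bdt_def fun_eq_iff diff_divide_distrib)

lemma bdt_Hh: "\<Phi> m \<in> Hh \<Longrightarrow> \<Phi> (m - 1) \<in> Hh \<Longrightarrow> bdt t \<Phi> m \<in> Hh"
  unfolding bdt_alt by (rule Hh_linear)

lemma bdt_Htilde: "\<Phi> m \<in> Htilde \<Longrightarrow> \<Phi> (m - 1) \<in> Htilde \<Longrightarrow> bdt t \<Phi> m \<in> Htilde"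
  unfolding bdt_alt by (rule Htilde_linear)

text \<open>
  Passage to the limit in the finite inequality, which is applied to \<open>f\<close> and \<open>g\<close> multiplied by
  \<open>sqrt w\<close>.
\<close>

lemma weighted_Cauchy_Schwarz:
  fixes f g w :: "nat \<Rightarrow> real"
  assumes w: "\<And>j. w j \<ge> 0"
    and f: "summable (\<lambda>j. f j * f j * w j)" and g: "summable (\<lambda>j. g j * g j * w j)"
    and fg: "summable (\<lambda>j. f j * g j * w j)"
  shows "\<bar>\<Sum>j. f j * g j * w j\<bar> \<le> sqrt (\<Sum>j. f j * f j * w j) * sqrt (\<Sum>j. g j * g j * w j)"
proof -
  have partial: "(\<Sum>j<n. f j * g j * w j)\<^sup>2 \<le> (\<Sum>j<n. f j * f j * w j) * (\<Sum>j<n. g j * g j * w j)" for n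
  proof -
    have root: "sqrt (w j) * sqrt (w j) = w j" for j using w by simp
    have eq: "u * sqrt (w j) * (v * sqrt (w j)) = u * v * w j" for u v j
      using root[of j] by (metis mult.assoc mult.left_commute)
    show ?thesis
      using Cauchy_Schwarz_ineq_sum[of "\<lambda>j. f j * sqrt (w j)" "\<lambda>j. g j * sqrt (w j)" "{..<n}"]
      by (simp only: power2_eq_square eq)
  qed
  have "(\<Sum>j. f j * g j * w j)\<^sup>2 \<le> (\<Sum>j. f j * f j * w j) * (\<Sum>j. g j * g j * w j)"
  proof (rule LIMSEQ_le)
    show "(\<lambda>n. (\<Sum>j<n. f j * g j * w j)\<^sup>2) \<longlonglongrightarrow> (\<Sum>j. f j * g j * w j)\<^sup>2"
      by (intro tendsto_power summable_LIMSEQ fg)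
    show "(\<lambda>n. (\<Sum>j<n. f j * f j * w j) * (\<Sum>j<n. g j * g j * w j))
        \<longlonglongrightarrow> (\<Sum>j. f j * f j * w j) * (\<Sum>j. g j * g j * w j)"
      by (intro tendsto_mult summable_LIMSEQ f g)
  qed (use partial in blast)
  then have "\<bar>\<Sum>j. f j * g j * w j\<bar> \<le> sqrt ((\<Sum>j. f j * f j * w j) * (\<Sum>j. g j * g j * w j))"
    by (metis real_sqrt_abs real_sqrt_le_mono)
  then show ?thesis by (simp add: real_sqrt_mult)
qed

section \<open>Forms as sums over mesh cells\<close>

text \<open>
  The contribution of the cell between the nodes \<open>j - 1\<close> and \<open>j\<close> to \<open>(C_op x \<theta> \<kappa> V, W)\<close>. The factor
  \<open>1/2 - \<theta>\<close> arises because the diagonal coefficient of \<open>C_op\<close> is an average over the two cells that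
  meet in a node, so that each cell receives half of \<open>1 - 2 * \<theta>\<close> at each of its end nodes.
\<close>

definition C_cell ::
  "(nat \<Rightarrow> real) \<Rightarrow> real \<Rightarrow> (nat \<Rightarrow> real) \<Rightarrow> (nat \<Rightarrow> real) \<Rightarrow> (nat \<Rightarrow> real) \<Rightarrow> nat \<Rightarrow> real" where
  "C_cell x \<theta> \<kappa> V W j = step x j * \<kappa> j *
     (\<theta> * (V (j - 1) * W j + V j * W (j - 1)) + (1/2 - \<theta>) * (V j * W j + V (j - 1) * W (j - 1)))"

definition L_cell ::
  "(nat \<Rightarrow> real) \<Rightarrow> real \<Rightarrow> (nat \<Rightarrow> real) \<Rightarrow> (nat \<Rightarrow> real) \<Rightarrow> (nat \<Rightarrow> real) \<Rightarrow> (nat \<Rightarrow> real) \<Rightarrow> nat \<Rightarrow> real"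
  where
  "L_cell x \<theta> bh ch V W j = bh j * bdx x V j * bdx x W j * step x j + C_cell x \<theta> ch V W j"

text \<open>
  The difference of the two sides is a multiple of a square: \<open>\<theta> * (u + v)^2\<close> if \<open>\<theta> \<ge> 0\<close> and
  \<open>- \<theta> * (u - v)^2\<close> otherwise.
\<close>

lemma C_cell_lower:
  assumes "\<theta> \<le> 1/4"
  shows "c_theta \<theta> / 2 * (u\<^sup>2 + v\<^sup>2) \<le> \<theta> * (v * u + u * v) + (1/2 - \<theta>) * (u * u + v * v)"
proof (cases "\<theta> \<ge> 0")
  case True
  have "\<theta> * (v * u + u * v) + (1/2 - \<theta>) * (u * u + v * v) - c_theta \<theta> / 2 * (u\<^sup>2 + v\<^sup>2) =
      \<theta> * (u + v)\<^sup>2"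
    using True by (simp add: c_theta_def power2_eq_square field_simps)
  moreover have "\<theta> * (u + v)\<^sup>2 \<ge> 0" using True by simp
  ultimately show ?thesis by linarith
next
  case False
  have "\<theta> * (v * u + u * v) + (1/2 - \<theta>) * (u * u + v * v) - c_theta \<theta> / 2 * (u\<^sup>2 + v\<^sup>2) =
      (- \<theta>) * (u - v)\<^sup>2"
    using False by (simp add: c_theta_def power2_eq_square field_simps)
  moreover have "(- \<theta>) * (u - v)\<^sup>2 \<ge> 0" using False by (intro mult_nonneg_nonneg) auto
  ultimately show ?thesis by linarith
qed

text \<open>
  Steps bounded from above and away from zero make every series below converge on square-summable mesh
  functions. At index \<open>0\<close> the bounds are harmless, as
  \<open>step x 0 = 0\<close> and \<open>inverse 0 = 0\<close>.
\<close>

locale mesh =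
  fixes x :: "nat \<Rightarrow> real"
  assumes step_pos: "step x (Suc j) > 0"
    and step_bounded: "Bseq (step x)"
    and inverse_step_bounded: "Bseq (\<lambda>j. inverse (step x j))"
begin

lemma hstep_pos: "hstep x (Suc j) > 0"
  using step_pos[of j] step_pos[of "Suc j"] by (simp add: hstep_def)

lemma hstep_bounded: "Bseq (hstep x)"
proof -
  obtain B where B: "B > 0" "\<And>n. \<bar>step x n\<bar> \<le> B"
    using step_bounded by (auto elim!: BseqE)
  show ?thesis
  proof (rule BseqI')
    fix n
    show "norm (hstep x n) \<le> B"
      using B(2)[of n] B(2)[of "Suc n"] by (simp add: hstep_def)
  qed
qed

lemma bdx_Htilde:
  assumes "V \<in> Hh" shows "bdx x V \<in> Htilde"
proof -
  note V = Hh_square_summable[OF assms]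
  have d: "summable (\<lambda>j. (V (Suc j) - V j)\<^sup>2)"
    using summable_square_linear[OF V(1,2), of 1 "-1"] by simp
  obtain B where B: "B > 0" "\<And>n. \<bar>inverse (step x n)\<bar> \<le> B"
    using inverse_step_bounded by (auto elim!: BseqE)
  have "summable (\<lambda>j. (bdx x V (Suc j))\<^sup>2)"
  proof (rule summable_comparison_test'[OF summable_mult[OF d, of "B\<^sup>2"]])
    fix n :: nat
    have "(inverse (step x (Suc n)))\<^sup>2 \<le> B\<^sup>2"
      using B by (metis abs_ge_zero power2_abs power_mono)
    then show "norm ((bdx x V (Suc n))\<^sup>2) \<le> B\<^sup>2 * (V (Suc n) - V n)\<^sup>2"
      by (simp add: bdx_def divide_inverse power_mult_distrib mult.commute[of "(V (Suc n) - V n)\<^sup>2"]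
          mult_right_mono)
  qed
  then show ?thesis by (simp add: Htilde_def)
qed

lemma Htilde_inner_summable:
  assumes "V \<in> Htilde" "W \<in> Htilde"
  shows "summable (\<lambda>j. V (Suc j) * W (Suc j) * step x (Suc j))"
  using summable_bounded_mult[of "\<lambda>j. V (Suc j)" "\<lambda>j. W (Suc j)" "\<lambda>j. step x (Suc j)"] assms step_bounded
  by (simp add: Htilde_def Bseq_Suc_iff mult_ac)

lemma Hh_inner_summable:
  assumes "V \<in> Hh" "W \<in> Hh"
  shows "summable (\<lambda>j. V (Suc j) * W (Suc j) * hstep x (Suc j))"
  using summable_bounded_mult[of "\<lambda>j. V (Suc j)" "\<lambda>j. W (Suc j)" "\<lambda>j. hstep x (Suc j)"] assms hstep_bounded
  by (simp add: Hh_def Bseq_Suc_iff mult_ac)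

lemma Htilde_inner_sums:
  assumes "V \<in> Htilde" "W \<in> Htilde"
  shows "(\<lambda>j. V (Suc j) * W (Suc j) * step x (Suc j)) sums Htilde_inner x V W"
  unfolding Htilde_inner_def by (intro summable_sums Htilde_inner_summable assms)

lemma Hh_inner_sums:
  assumes "V \<in> Hh" "W \<in> Hh"
  shows "(\<lambda>j. V (Suc j) * W (Suc j) * hstep x (Suc j)) sums Hh_inner x V W"
  unfolding Hh_inner_def by (intro summable_sums Hh_inner_summable assms)

lemma Htilde_inner_nonneg: "V \<in> Htilde \<Longrightarrow> Htilde_inner x V V \<ge> 0"
  unfolding Htilde_inner_def
  by (intro suminf_nonneg Htilde_inner_summable) (auto simp: less_imp_le[OF step_pos])

lemma Hh_inner_nonneg: "V \<in> Hh \<Longrightarrow> Hh_inner x V V \<ge> 0"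
  unfolding Hh_inner_def
  by (intro suminf_nonneg Hh_inner_summable) (auto simp: less_imp_le[OF hstep_pos])

lemma Htilde_norm_nonneg: "V \<in> Htilde \<Longrightarrow> Htilde_norm x V \<ge> 0"
  using Htilde_inner_nonneg by (simp add: Htilde_norm_def)

lemma Htilde_Cauchy_Schwarz:
  assumes "V \<in> Htilde" "W \<in> Htilde"
  shows "\<bar>Htilde_inner x V W\<bar> \<le> Htilde_norm x V * Htilde_norm x W"
  unfolding Htilde_inner_def Htilde_norm_def
  by (intro weighted_Cauchy_Schwarz Htilde_inner_summable assms less_imp_le[OF step_pos])

lemma Hh_Cauchy_Schwarz:
  assumes "V \<in> Hh" "W \<in> Hh"
  shows "\<bar>Hh_inner x V W\<bar> \<le> Hh_norm x V * Hh_norm x W"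
  unfolding Hh_inner_def Hh_norm_def
  by (intro weighted_Cauchy_Schwarz Hh_inner_summable assms less_imp_le[OF hstep_pos])

text \<open>
  The triangle inequality in the form in which it is applied to one time step of \<open>F1\<close>, with \<open>q\<close> the
  time step and \<open>W\<close> the difference quotient.
\<close>

lemma Htilde_norm_add_scaled:
  assumes V: "V \<in> Htilde" and W: "W \<in> Htilde" and q: "q \<ge> 0"
  shows "Htilde_norm x (\<lambda>j. V j + q * W j) \<le> Htilde_norm x V + q * Htilde_norm x W"
proof -
  have VW: "(\<lambda>j. V j + q * W j) \<in> Htilde"
    using Htilde_linear[OF V W, of 1 q] by simp
  note sums = Htilde_inner_sums[OF V V] Htilde_inner_sums[OF V W] Htilde_inner_sums[OF W W]
  have "(\<lambda>j. (V (Suc j) + q * W (Suc j)) * (V (Suc j) + q * W (Suc j)) * step x (Suc j)) sums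
      (Htilde_inner x V V + 2 * q * Htilde_inner x V W + q\<^sup>2 * Htilde_inner x W W)"
    using sums_add[OF sums_add[OF sums(1) sums_mult[OF sums(2), of "2 * q"]]
        sums_mult[OF sums(3), of "q\<^sup>2"]]
    by (simp add: algebra_simps power2_eq_square)
  then have "Htilde_inner x (\<lambda>j. V j + q * W j) (\<lambda>j. V j + q * W j) =
      Htilde_inner x V V + 2 * q * Htilde_inner x V W + q\<^sup>2 * Htilde_inner x W W"
    using Htilde_inner_sums[OF VW VW] sums_unique2 by blast
  also have "\<dots> \<le> (Htilde_norm x V + q * Htilde_norm x W)\<^sup>2"
  proof -
    have "q * Htilde_inner x V W \<le> q * (Htilde_norm x V * Htilde_norm x W)"
      using Htilde_Cauchy_Schwarz[OF V W] q by (intro mult_left_mono) auto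
    moreover have "(Htilde_norm x V)\<^sup>2 = Htilde_inner x V V" "(Htilde_norm x W)\<^sup>2 = Htilde_inner x W W"
      using Htilde_inner_nonneg V W by (simp_all add: Htilde_norm_def)
    ultimately show ?thesis by (simp add: power2_sum power_mult_distrib mult_ac)
  qed
  finally show ?thesis
    unfolding Htilde_norm_def[of x "\<lambda>j. V j + q * W j"]
    using q Htilde_inner_nonneg V W
    by (intro real_le_lsqrt) (auto simp: Htilde_norm_def)
qed

text \<open>
  With \<open>p j = G (j + 1) * D j\<close>, the terms of the two series differ by \<open>p (j + 1) - p j\<close>, which
  sums to zero because \<open>p 0 = 0\<close> and \<open>p\<close> tends to zero.
\<close>

lemma hdx_summation_by_parts:
  assumes G: "G \<in> Htilde" and D: "D \<in> Hh"
  shows "(\<lambda>j. hdx x G (Suc j) * D (Suc j) * hstep x (Suc j)) sums (- Htilde_inner x G (bdx x D))"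
proof -
  note d = Hh_square_summable[OF D]
  have g: "summable (\<lambda>j. (G (Suc j))\<^sup>2)" using G by (simp add: Htilde_def)
  define p where "p j = G (Suc j) * D j" for j
  have "summable p"
    using summable_bounded_mult[OF g d(2), of "\<lambda>_. 1"] by (simp add: p_def[abs_def])
  then have "p sums suminf p" by (rule summable_sums)
  then have shift: "(\<lambda>j. p (Suc j)) sums suminf p"
    using sums_Suc_iff[of p "suminf p"] d(3) by (simp add: p_def)
  have telescope: "(\<lambda>j. p (Suc j) - p j) sums 0"
    using sums_diff[OF shift \<open>p sums suminf p\<close>] by simp
  have "hdx x G (Suc j) * D (Suc j) * hstep x (Suc j) =
      (p (Suc j) - p j) - G (Suc j) * bdx x D (Suc j) * step x (Suc j)" for j
    using hstep_pos[of j] step_pos[of j] by (simp add: hdx_def bdx_def p_def field_simps)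
  then show ?thesis
    using sums_diff[OF telescope Htilde_inner_sums[OF G bdx_Htilde[OF D]]] by simp
qed

text \<open>
  Each cell is split into its contribution \<open>q\<close> to the right end node and its contribution \<open>p\<close> to
  the left one. The node \<open>j + 1\<close> collects \<open>q j\<close> from the cell on its left and \<open>p (j + 1)\<close> from
  the cell on its right, so the sums over nodes and over cells agree up to \<open>p 0\<close>, which vanishes since
  \<open>V 0 = W 0 = 0\<close>.
\<close>

lemma C_form_sums:
  assumes \<kappa>: "Bseq \<kappa>" and V: "V \<in> Hh" and W: "W \<in> Hh"
  shows "(\<lambda>j. C_op x \<theta> \<kappa> V (Suc j) * W (Suc j) * hstep x (Suc j)) sums
           Hh_inner x (C_op x \<theta> \<kappa> V) W" (is ?nodes)
    and "(\<lambda>j. C_cell x \<theta> \<kappa> V W (Suc j)) sums Hh_inner x (C_op x \<theta> \<kappa> V) W" (is ?cells)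
proof -
  note v = Hh_square_summable[OF V] and w = Hh_square_summable[OF W]
  define k where "k j = step x (Suc j) * \<kappa> (Suc j)" for j
  have k: "Bseq k"
    using Bseq_mult[OF step_bounded \<kappa>] Bseq_Suc_iff[of "\<lambda>j. step x j * \<kappa> j"]
    by (simp add: k_def[abs_def])
  define p where "p j = k j * (\<theta> * (V (Suc j) * W j) + (1/2 - \<theta>) * (V j * W j))" for j
  define q where "q j = k j * (\<theta> * (V j * W (Suc j)) + (1/2 - \<theta>) * (V (Suc j) * W (Suc j)))" for j
  have "summable (\<lambda>j. \<theta> * (k j * (V (Suc j) * W j)) + (1/2 - \<theta>) * (k j * (V j * W j)))"
    by (intro summable_add summable_mult summable_bounded_mult v w k)
  then have p: "summable p" by (simp add: p_def[abs_def] algebra_simps)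
  have "summable (\<lambda>j. \<theta> * (k j * (V j * W (Suc j))) + (1/2 - \<theta>) * (k j * (V (Suc j) * W (Suc j))))"
    by (intro summable_add summable_mult summable_bounded_mult v w k)
  then have q: "summable q" by (simp add: q_def[abs_def] algebra_simps)
  have node: "C_op x \<theta> \<kappa> V (Suc j) * W (Suc j) * hstep x (Suc j) = q j + p (Suc j)" for j
  proof -
    let ?H = "hstep x (Suc j)"
    have H: "?H \<noteq> 0" using hstep_pos[of j] by simp
    have cancel: "a / ?H * ?H = a" "a / (2 * ?H) * ?H = a / 2" for a using H by simp_all
    have "C_op x \<theta> \<kappa> V (Suc j) * W (Suc j) * ?H =
        \<theta> * (step x (Suc j) / ?H * ?H) * \<kappa> (Suc j) * V j * W (Suc j)
        + (1 - 2 * \<theta>) * ((step x (Suc j) / (2 * ?H) * ?H) * \<kappa> (Suc j)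
            + (step x (Suc (Suc j)) / (2 * ?H) * ?H) * \<kappa> (Suc (Suc j))) * V (Suc j) * W (Suc j)
        + \<theta> * (step x (Suc (Suc j)) / ?H * ?H) * \<kappa> (Suc (Suc j)) * V (Suc (Suc j)) * W (Suc j)"
      by (simp only: C_op_def hsx_def Suc_eq_plus1[symmetric] diff_Suc_1 distrib_left distrib_right mult_ac)
    also have "\<dots> = q j + p (Suc j)"
      unfolding cancel by (simp add: p_def q_def k_def field_simps)
    finally show ?thesis .
  qed
  have cell: "C_cell x \<theta> \<kappa> V W (Suc j) = q j + p j" for j
    by (simp add: C_cell_def p_def q_def k_def algebra_simps)
  have ps: "p sums suminf p" by (rule summable_sums[OF p])
  then have "(\<lambda>j. p (Suc j)) sums suminf p"
    using sums_Suc_iff[of p "suminf p"] v(3) w(3) by (simp add: p_def)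
  then have nodes: "(\<lambda>j. q j + p (Suc j)) sums (suminf q + suminf p)"
    by (intro sums_add summable_sums q)
  then have total: "Hh_inner x (C_op x \<theta> \<kappa> V) W = suminf q + suminf p"
    unfolding Hh_inner_def node by (rule sums_unique[symmetric])
  show ?nodes unfolding node total by (rule nodes)
  show ?cells unfolding cell total by (intro sums_add ps summable_sums q)
qed

lemma L_form_sums:
  assumes "Bseq bh" "Bseq ch" "V \<in> Hh" "W \<in> Hh"
  shows "(\<lambda>j. L_cell x \<theta> bh ch V W (Suc j)) sums L_form x \<theta> bh ch V W"
  unfolding L_cell_def L_form_def
  by (intro sums_add C_form_sums Htilde_inner_sums bounded_mult_Htilde bdx_Htilde assms)

lemma A_op_sums:
  assumes "Bseq bh" "Bseq ch" "V \<in> Hh" "W \<in> Hh"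
  shows "(\<lambda>j. A_op x \<theta> bh ch V (Suc j) * W (Suc j) * hstep x (Suc j)) sums L_form x \<theta> bh ch V W"
proof -
  have "(\<lambda>j. - (hdx x (\<lambda>i. bh i * bdx x V i) (Suc j) * W (Suc j) * hstep x (Suc j))
      + C_op x \<theta> ch V (Suc j) * W (Suc j) * hstep x (Suc j)) sums
      (- (- Htilde_inner x (\<lambda>i. bh i * bdx x V i) (bdx x W)) + Hh_inner x (C_op x \<theta> ch V) W)"
    by (intro sums_add sums_minus hdx_summation_by_parts C_form_sums bounded_mult_Htilde
        bdx_Htilde assms)
  then show ?thesis by (simp add: A_op_def L_form_def algebra_simps)
qed

section \<open>Coercivity and differences of squares\<close>

text \<open>
  For \<open>\<theta> = 0\<close> and \<open>\<kappa> = 1\<close> the operator \<open>C_op\<close> is the identity on the nodes \<open>j \<ge> 1\<close>, so that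
  the cell representation covers the norm of \<open>Hh\<close> as well and the claim can be checked cell by cell.
\<close>

lemma C_form_coercive:
  assumes \<kappa>: "Bseq \<kappa>" "\<And>j. \<kappa> (Suc j) \<ge> \<kappa>low" "\<kappa>low \<ge> 0" and \<theta>: "\<theta> \<le> 1/4" and W: "W \<in> Hh"
  shows "c_theta \<theta> * \<kappa>low * (Hh_norm x W)\<^sup>2 \<le> Hh_inner x (C_op x \<theta> \<kappa> W) W"
proof -
  have "hsx x (\<lambda>_. 1) (Suc j) = 1" for j
  proof -
    have "hsx x (\<lambda>_. 1) (Suc j) = (step x (Suc j) + step x (Suc j + 1)) / (2 * hstep x (Suc j))"
      by (simp add: hsx_def add_divide_distrib)
    also have "step x (Suc j) + step x (Suc j + 1) = 2 * hstep x (Suc j)"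
      by (simp add: hstep_def)
    finally show ?thesis using hstep_pos[of j] by simp
  qed
  then have "C_op x 0 (\<lambda>_. 1) W (Suc j) = W (Suc j)" for j
    by (simp add: C_op_def)
  then have one: "Hh_inner x (C_op x 0 (\<lambda>_. 1) W) W = (Hh_norm x W)\<^sup>2"
    using Hh_inner_nonneg[OF W] by (simp add: Hh_inner_def Hh_norm_def)
  have mass: "(\<lambda>j. C_cell x 0 (\<lambda>_. 1) W W (Suc j)) sums (Hh_norm x W)\<^sup>2"
    using C_form_sums(2)[of "\<lambda>_. 1" W W 0] W unfolding one by simp
  have c: "c_theta \<theta> \<ge> 0" using \<theta> by (auto simp: c_theta_def)
  have "c_theta \<theta> * \<kappa>low * C_cell x 0 (\<lambda>_. 1) W W (Suc j) \<le> C_cell x \<theta> \<kappa> W W (Suc j)" for j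
  proof -
    let ?u = "W (Suc j)" and ?v = "W j" and ?s = "step x (Suc j)"
    have s: "?s \<ge> 0" using step_pos[of j] by simp
    have "c_theta \<theta> * \<kappa>low * C_cell x 0 (\<lambda>_. 1) W W (Suc j) =
        ?s * \<kappa>low * (c_theta \<theta> / 2 * (?u\<^sup>2 + ?v\<^sup>2))"
      by (simp add: C_cell_def power2_eq_square)
    also have "\<dots> \<le> ?s * \<kappa> (Suc j) * (c_theta \<theta> / 2 * (?u\<^sup>2 + ?v\<^sup>2))"
      using s \<kappa>(2)[of j] c by (intro mult_right_mono mult_left_mono) auto
    also have "\<dots> \<le> C_cell x \<theta> \<kappa> W W (Suc j)"
      unfolding C_cell_def diff_Suc_1
      using s \<kappa>(2)[of j] \<kappa>(3) by (intro mult_left_mono C_cell_lower \<theta>) auto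
    finally show ?thesis .
  qed
  then show ?thesis
    by (rule sums_le[OF _ sums_mult[OF mass] C_form_sums(2)[OF \<kappa>(1) W W]])
qed

lemma C_form_nonneg:
  assumes "Bseq \<kappa>" "\<And>j. \<kappa> (Suc j) \<ge> 0" "\<theta> \<le> 1/4" "W \<in> Hh"
  shows "Hh_inner x (C_op x \<theta> \<kappa> W) W \<ge> 0"
  using C_form_coercive[OF assms(1,2) order_refl assms(3,4)] by simp

lemma L_form_coercive:
  assumes "Bseq bh" "Bseq ch" "\<And>j. bh (Suc j) \<ge> \<nu>" "\<And>j. ch (Suc j) \<ge> 0" "\<theta> \<le> 1/4" "W \<in> Hh"
  shows "\<nu> * (Htilde_norm x (bdx x W))\<^sup>2 \<le> L_form x \<theta> bh ch W W"
proof -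
  note d = bdx_Htilde[OF assms(6)]
  have "\<nu> * Htilde_inner x (bdx x W) (bdx x W) \<le> Htilde_inner x (\<lambda>j. bh j * bdx x W j) (bdx x W)"
  proof (rule sums_le[OF _ sums_mult[OF Htilde_inner_sums[OF d d]]
        Htilde_inner_sums[OF bounded_mult_Htilde[OF assms(1) d] d]])
    fix j
    have "\<nu> * (bdx x W (Suc j) * bdx x W (Suc j) * step x (Suc j))
        \<le> bh (Suc j) * (bdx x W (Suc j) * bdx x W (Suc j) * step x (Suc j))"
      using step_pos[of j] assms(3)[of j] by (intro mult_right_mono) auto
    then show "\<nu> * (bdx x W (Suc j) * bdx x W (Suc j) * step x (Suc j))
        \<le> bh (Suc j) * bdx x W (Suc j) * bdx x W (Suc j) * step x (Suc j)"
      by (simp add: mult.assoc)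
  qed
  then show ?thesis
    using C_form_nonneg[OF assms(2,4,5,6)] Htilde_inner_nonneg[OF d]
    by (simp add: L_form_def Htilde_norm_def)
qed

lemma L_form_nonneg:
  assumes "Bseq bh" "Bseq ch" "\<And>j. bh (Suc j) \<ge> 0" "\<And>j. ch (Suc j) \<ge> 0" "\<theta> \<le> 1/4" "W \<in> Hh"
  shows "L_form x \<theta> bh ch W W \<ge> 0"
  using L_form_coercive[OF assms] by simp

text \<open>
  The origin of the condition on \<open>\<sigma>\<close>. In a symmetric bilinear form, with \<open>V = W + \<tau> * D\<close>,
  the value \<open>S = W + \<sigma> * \<tau> * D\<close> is the midpoint \<open>(V + W) / 2\<close> plus \<open>(\<sigma> - 1/2) * \<tau> * D\<close>, and the
  midpoint tested with \<open>V - W\<close> gives the difference of squares. The identity already holds in each cell.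
\<close>

lemma L_form_time_step:
  assumes "Bseq bh" "Bseq ch" and Hh: "V \<in> Hh" "W \<in> Hh" "S \<in> Hh" "D \<in> Hh"
    and V: "\<And>j. V j = W j + \<tau> * D j" and S: "\<And>j. S j = W j + \<sigma> * \<tau> * D j"
  shows "2 * \<tau> * L_form x \<theta> bh ch S D =
    L_form x \<theta> bh ch V V - L_form x \<theta> bh ch W W + 2 * (\<sigma> - 1/2) * \<tau>\<^sup>2 * L_form x \<theta> bh ch D D"
proof -
  note sums = L_form_sums[OF assms(1,2)]
  have bV: "bdx x V j = bdx x W j + \<tau> * bdx x D j" for j
    by (simp add: bdx_def V diff_divide_distrib add_divide_distrib algebra_simps)
  have bS: "bdx x S j = bdx x W j + \<sigma> * \<tau> * bdx x D j" for j
    by (simp add: bdx_def S diff_divide_distrib add_divide_distrib algebra_simps)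
  have "2 * \<tau> * L_cell x \<theta> bh ch S D j = L_cell x \<theta> bh ch V V j - L_cell x \<theta> bh ch W W j
      + 2 * (\<sigma> - 1/2) * \<tau>\<^sup>2 * L_cell x \<theta> bh ch D D j" for j
    unfolding L_cell_def C_cell_def bV bS V S by (simp add: field_simps power2_eq_square)
  then have "(\<lambda>j. 2 * \<tau> * L_cell x \<theta> bh ch S D (Suc j)) sums
      (L_form x \<theta> bh ch V V - L_form x \<theta> bh ch W W + 2 * (\<sigma> - 1/2) * \<tau>\<^sup>2 * L_form x \<theta> bh ch D D)"
    by (auto intro!: sums_add sums_diff sums_mult sums Hh)
  then show ?thesis
    using sums_mult[OF sums[OF Hh(3,4)]] sums_unique2 by blast
qed

end

section \<open>The energy method\<close>

text \<open>
  The locale includes the limiting case \<open>\<theta> = 1/4\<close>, in which the form of \<open>C_op\<close> need not control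
  the norm of \<open>Hh\<close>; for \<open>\<theta> < 1/4\<close> the positive lower bound of \<open>\<rho>h\<close> determines the constant
  \<open>K\<close> of \<open>source_estimate\<close>.
\<close>

locale scheme = mesh x for x :: "nat \<Rightarrow> real" +
  fixes t :: "nat \<Rightarrow> real" and \<sigma> \<theta> \<nu> :: real and \<rho>h bh ch :: "nat \<Rightarrow> real"
    and F0 F1 U :: "nat \<Rightarrow> nat \<Rightarrow> real"
  assumes coeff_bounded: "Bseq \<rho>h" "Bseq bh" "Bseq ch"
    and \<nu>: "\<nu> > 0"
    and coeff_lower: "\<rho>h (Suc j) \<ge> 0" "bh (Suc j) \<ge> \<nu>" "ch (Suc j) \<ge> 0"
    and \<theta>: "\<theta> \<le> 1/4" and \<sigma>: "\<sigma> \<ge> 1/2"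
    and time_step: "m \<ge> 1 \<Longrightarrow> step t m > 0"
    and F0: "m \<ge> 1 \<Longrightarrow> F0 m \<in> Hh" and F1: "F1 m \<in> Htilde" and U: "U m \<in> Hh"
    and equation: "m \<ge> 1 \<Longrightarrow> j \<ge> 1 \<Longrightarrow>
      C_op x \<theta> \<rho>h (bdt t U m) j + A_op x \<theta> bh ch (t_weighted \<sigma> U m) j = F0 m j + hdx x (F1 m) j"
begin

abbreviation D :: "nat \<Rightarrow> nat \<Rightarrow> real" where "D \<equiv> bdt t U"
abbreviation LL :: "(nat \<Rightarrow> real) \<Rightarrow> real" where "LL \<equiv> L_norm x \<theta> bh ch"
abbreviation CC :: "(nat \<Rightarrow> real) \<Rightarrow> real" where "CC \<equiv> C_norm x \<theta> \<rho>h"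

lemma D_Hh: "D m \<in> Hh" by (intro bdt_Hh U)

lemma bdt_F1: "bdt t F1 m \<in> Htilde" by (intro bdt_Htilde F1)

lemma L_norm_sq: "W \<in> Hh \<Longrightarrow> (LL W)\<^sup>2 = L_form x \<theta> bh ch W W"
  using L_form_nonneg[OF coeff_bounded(2,3) _ coeff_lower(3) \<theta>] coeff_lower(2) \<nu>
  by (simp add: L_norm_def) (meson less_imp_le order_trans)

lemma L_norm_nonneg: "W \<in> Hh \<Longrightarrow> LL W \<ge> 0"
  using L_form_nonneg[OF coeff_bounded(2,3) _ coeff_lower(3) \<theta>] coeff_lower(2) \<nu>
  by (simp add: L_norm_def) (meson less_imp_le order_trans)

lemma C_norm_sq: "W \<in> Hh \<Longrightarrow> (CC W)\<^sup>2 = Hh_inner x (C_op x \<theta> \<rho>h W) W"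
  using C_form_nonneg[OF coeff_bounded(1) coeff_lower(1) \<theta>] by (simp add: C_norm_def)

text \<open>
  This is where the factor \<open>1 / sqrt \<nu>\<close> in front of the terms with \<open>F1\<close> comes from.
\<close>

lemma bdx_norm_le:
  assumes "W \<in> Hh" shows "Htilde_norm x (bdx x W) \<le> LL W / sqrt \<nu>"
proof -
  have "sqrt \<nu> * Htilde_norm x (bdx x W) = sqrt (\<nu> * (Htilde_norm x (bdx x W))\<^sup>2)"
    using Htilde_inner_nonneg[OF bdx_Htilde[OF assms]]
    by (simp add: real_sqrt_mult Htilde_norm_def)
  also have "\<dots> \<le> LL W"
    unfolding L_norm_def
    using L_form_coercive[OF coeff_bounded(2,3) coeff_lower(2,3) \<theta> assms] by simp
  finally show ?thesis using \<nu> by (simp add: field_simps)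
qed

lemma energy_step:
  assumes m: "m \<ge> 1"
  shows "(LL (U m))\<^sup>2 - (LL (U (m - 1)))\<^sup>2
      + 2 * ((\<sigma> - 1/2) * step t m * (LL (D m))\<^sup>2 * step t m + (CC (D m))\<^sup>2 * step t m) =
    2 * (Hh_inner x (F0 m) (D m) * step t m) - 2 * (Htilde_inner x (F1 m) (bdx x (D m)) * step t m)"
proof -
  let ?\<tau> = "step t m" and ?S = "t_weighted \<sigma> U m"
  have \<tau>: "?\<tau> > 0" by (rule time_step[OF m])
  have S: "?S \<in> Hh"
    unfolding t_weighted_def[abs_def] by (intro Hh_linear U)
  have "(\<lambda>j. (C_op x \<theta> \<rho>h (D m) (Suc j) + A_op x \<theta> bh ch ?S (Suc j)) * D m (Suc j) * hstep x (Suc j))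
      sums (Hh_inner x (C_op x \<theta> \<rho>h (D m)) (D m) + L_form x \<theta> bh ch ?S (D m))"
    unfolding distrib_right by (intro sums_add C_form_sums A_op_sums coeff_bounded S D_Hh)
  moreover have "(\<lambda>j. (F0 m (Suc j) + hdx x (F1 m) (Suc j)) * D m (Suc j) * hstep x (Suc j))
      sums (Hh_inner x (F0 m) (D m) + - Htilde_inner x (F1 m) (bdx x (D m)))"
    unfolding distrib_right by (intro sums_add Hh_inner_sums hdx_summation_by_parts F0 F1 m D_Hh)
  ultimately have tested: "Hh_inner x (C_op x \<theta> \<rho>h (D m)) (D m) + L_form x \<theta> bh ch ?S (D m) =
      Hh_inner x (F0 m) (D m) - Htilde_inner x (F1 m) (bdx x (D m))"
    using equation[OF m] sums_unique2 by fastforce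
  have "2 * ?\<tau> * L_form x \<theta> bh ch ?S (D m) = (LL (U m))\<^sup>2 - (LL (U (m - 1)))\<^sup>2
      + 2 * (\<sigma> - 1/2) * ?\<tau>\<^sup>2 * (LL (D m))\<^sup>2"
    unfolding L_norm_sq[OF U] L_norm_sq[OF D_Hh]
    using \<tau> by (intro L_form_time_step coeff_bounded U S D_Hh)
      (simp_all add: bdt_def t_weighted_def field_simps)
  then show ?thesis
    using arg_cong[OF tested, of "\<lambda>r. 2 * ?\<tau> * r"]
    unfolding C_norm_sq[OF D_Hh] by (simp add: algebra_simps power2_eq_square)
qed

text \<open>
  The square of \<open>norm2\<close>, with the number of time levels as the only argument.
\<close>

definition dissipation :: "nat \<Rightarrow> real" where
  "dissipation n = (\<Sum>m=1..n. (\<sigma> - 1/2) * step t m * (LL (D m))\<^sup>2 * step t m)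
     + (\<Sum>m=1..n. (CC (D m))\<^sup>2 * step t m)"

lemma energy_balance:
  "(LL (U n))\<^sup>2 + 2 * dissipation n = (LL (U 0))\<^sup>2
     + 2 * (\<Sum>m=1..n. Hh_inner x (F0 m) (D m) * step t m)
     - 2 * (\<Sum>m=1..n. Htilde_inner x (F1 m) (bdx x (D m)) * step t m)"
proof (induction n)
  case 0
  then show ?case by (simp add: dissipation_def)
next
  case (Suc n)
  then show ?case
    using energy_step[of "Suc n"] by (simp add: dissipation_def algebra_simps)
qed

text \<open>
  The discrete product rule \<open>f * (u - u') = (f * u - f' * u') - (f - f') * u'\<close>, primes denoting
  the previous time level.
\<close>

lemma time_Abel_step:
  assumes "m \<ge> 1"
  shows "Htilde_inner x (F1 m) (bdx x (D m)) * step t m =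
    Htilde_inner x (F1 m) (bdx x (U m)) - Htilde_inner x (F1 (m - 1)) (bdx x (U (m - 1)))
    - Htilde_inner x (bdt t F1 m) (bdx x (U (m - 1))) * step t m"
proof -
  note s = Htilde_inner_sums[OF _ bdx_Htilde]
  have \<tau>: "step t m \<noteq> 0" using time_step[OF assms] by simp
  have bD: "bdx x (D m) j = (bdx x (U m) j - bdx x (U (m - 1)) j) / step t m" for j
    by (simp add: bdx_def bdt_def diff_divide_distrib mult.commute)
  have "(\<lambda>j. F1 m (Suc j) * bdx x (D m) (Suc j) * step x (Suc j) * step t m) sums
      (Htilde_inner x (F1 m) (bdx x (D m)) * step t m)"
    by (intro sums_mult2 s F1 D_Hh)
  moreover have "(\<lambda>j. F1 m (Suc j) * bdx x (U m) (Suc j) * step x (Suc j)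
        - F1 (m - 1) (Suc j) * bdx x (U (m - 1)) (Suc j) * step x (Suc j)
        - bdt t F1 m (Suc j) * bdx x (U (m - 1)) (Suc j) * step x (Suc j) * step t m) sums
      (Htilde_inner x (F1 m) (bdx x (U m)) - Htilde_inner x (F1 (m - 1)) (bdx x (U (m - 1)))
        - Htilde_inner x (bdt t F1 m) (bdx x (U (m - 1))) * step t m)"
    by (intro sums_diff sums_mult2 s F1 bdt_F1 U)
  moreover have "F1 m i * bdx x (D m) i * w * step t m =
      F1 m i * bdx x (U m) i * w - F1 (m - 1) i * bdx x (U (m - 1)) i * w
      - bdt t F1 m i * bdx x (U (m - 1)) i * w * step t m" for i w
    using \<tau> unfolding bD bdt_def[of t F1] by (simp add: field_simps)
  ultimately show ?thesis using sums_unique2 by fastforce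
qed

lemma time_Abel:
  "(\<Sum>m=1..n. Htilde_inner x (F1 m) (bdx x (D m)) * step t m) =
    Htilde_inner x (F1 n) (bdx x (U n)) - Htilde_inner x (F1 0) (bdx x (U 0))
    - (\<Sum>m=1..n. Htilde_inner x (bdt t F1 m) (bdx x (U (m - 1))) * step t m)"
proof (induction n)
  case (Suc n)
  then show ?case using time_Abel_step[of "Suc n"] by simp
qed simp

definition flux_bound :: "nat \<Rightarrow> real" where
  "flux_bound n = Htilde_norm x (F1 0) + (\<Sum>m=1..n. Htilde_norm x (bdt t F1 m) * step t m)"

lemma F1_norm_le: "Htilde_norm x (F1 n) \<le> flux_bound n"
proof (induction n)
  case 0
  then show ?case by (simp add: flux_bound_def)
next
  case (Suc n)
  have \<tau>: "step t (Suc n) > 0" by (rule time_step) simp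
  have "F1 (Suc n) = (\<lambda>j. F1 n j + step t (Suc n) * bdt t F1 (Suc n) j)"
    using \<tau> by (simp add: bdt_def fun_eq_iff)
  then have "Htilde_norm x (F1 (Suc n))
      \<le> Htilde_norm x (F1 n) + step t (Suc n) * Htilde_norm x (bdt t F1 (Suc n))"
    using Htilde_norm_add_scaled[OF F1 bdt_F1 less_imp_le[OF \<tau>], of n "Suc n"]
    by simp
  then show ?case using Suc by (simp add: flux_bound_def mult.commute)
qed

lemma flux_bound_mono:
  assumes "n \<le> M" shows "flux_bound n \<le> flux_bound M"
  unfolding flux_bound_def using assms
  by (intro add_left_mono sum_mono2)
    (auto intro!: mult_nonneg_nonneg Htilde_norm_nonneg bdt_Htilde F1 less_imp_le[OF time_step])

text \<open>
  After Abel summation three kinds of terms remain: the boundary terms at levels \<open>n\<close> and \<open>0\<close> and the sum with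
  the differences of \<open>F1\<close>. The first is at most \<open>flux_bound n\<close>, the other two add up to another
  \<open>flux_bound n\<close> (both times \<open>y / sqrt \<nu>\<close>); together with the factor \<open>2\<close> in the energy balance this gives
  the constant \<open>4\<close>.
\<close>

lemma flux_estimate:
  assumes y: "\<And>m. m \<le> n \<Longrightarrow> LL (U m) \<le> y"
  shows "- 2 * (\<Sum>m=1..n. Htilde_inner x (F1 m) (bdx x (D m)) * step t m)
    \<le> 4 / sqrt \<nu> * flux_bound n * y"
proof -
  have term_le: "\<bar>Htilde_inner x G (bdx x (U m))\<bar> \<le> Htilde_norm x G * (y / sqrt \<nu>)"
    if "G \<in> Htilde" "m \<le> n" for G m
  proof -
    have "\<bar>Htilde_inner x G (bdx x (U m))\<bar> \<le> Htilde_norm x G * Htilde_norm x (bdx x (U m))"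
      by (intro Htilde_Cauchy_Schwarz bdx_Htilde U that)
    also have "\<dots> \<le> Htilde_norm x G * (y / sqrt \<nu>)"
      using bdx_norm_le[OF U, of m] y[OF that(2)] \<nu>
      by (intro mult_left_mono Htilde_norm_nonneg that)
        (meson divide_right_mono order_trans real_sqrt_ge_zero less_imp_le)
    finally show ?thesis .
  qed
  have "(\<Sum>m=1..n. Htilde_inner x (bdt t F1 m) (bdx x (U (m - 1))) * step t m)
      \<le> (\<Sum>m=1..n. Htilde_norm x (bdt t F1 m) * (y / sqrt \<nu>) * step t m)"
  proof (intro sum_mono mult_right_mono)
    fix m assume m: "m \<in> {1..n}"
    show "Htilde_inner x (bdt t F1 m) (bdx x (U (m - 1))) \<le> Htilde_norm x (bdt t F1 m) * (y / sqrt \<nu>)"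
      using term_le[OF bdt_F1, of "m - 1" m] m by force
    show "0 \<le> step t m" using time_step[of m] m by simp
  qed
  also have "\<dots> = (\<Sum>m=1..n. Htilde_norm x (bdt t F1 m) * step t m) * (y / sqrt \<nu>)"
    unfolding sum_distrib_right by (simp only: mult_ac)
  finally have sum_le: "(\<Sum>m=1..n. Htilde_inner x (bdt t F1 m) (bdx x (U (m - 1))) * step t m) \<le> \<dots>" .
  have y0: "y \<ge> 0" using y[of 0] L_norm_nonneg[OF U, of 0] by simp
  have F1n: "Htilde_norm x (F1 n) * (y / sqrt \<nu>) \<le> flux_bound n * (y / sqrt \<nu>)"
    using F1_norm_le[of n] y0 \<nu> by (intro mult_right_mono) auto
  have "- (\<Sum>m=1..n. Htilde_inner x (F1 m) (bdx x (D m)) * step t m) \<le> 2 * (flux_bound n * (y / sqrt \<nu>))"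
    unfolding time_Abel
    using sum_le F1n term_le[OF F1, of n n] term_le[OF F1, of 0 0]
    unfolding flux_bound_def distrib_right by simp
  then show ?thesis by simp
qed

lemma dissipation_terms_nonneg:
  assumes "m \<ge> 1"
  shows "(\<sigma> - 1/2) * step t m * (LL (D m))\<^sup>2 * step t m \<ge> 0" "(CC (D m))\<^sup>2 * step t m \<ge> 0"
  using time_step[OF assms] \<sigma> by simp_all

lemma dissipation_mono: "n \<le> M \<Longrightarrow> dissipation n \<le> dissipation M"
  unfolding dissipation_def
  by (intro add_mono sum_mono2) (auto intro!: dissipation_terms_nonneg)

text \<open>
  The constant \<open>K\<close> is a parameter so that both ranges of \<open>\<theta>\<close> are treated at once: coercivity
  provides it for \<open>\<theta> < 1/4\<close>, and \<open>K = 0\<close> serves for \<open>\<theta> = 1/4\<close> with vanishing \<open>F0\<close>. The sum is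
  estimated by the Cauchy--Schwarz inequality over the time levels, with the root of each time step given to
  either factor.
\<close>

lemma source_estimate:
  assumes K: "K \<ge> 0"
    and test: "\<And>m. m \<ge> 1 \<Longrightarrow> Hh_inner x (F0 m) (D m) \<le> K * (Hh_norm x (F0 m) * CC (D m))"
  shows "(\<Sum>m=1..n. Hh_inner x (F0 m) (D m) * step t m)
    \<le> K * sqrt (\<Sum>m=1..n. (Hh_norm x (F0 m))\<^sup>2 * step t m) * sqrt (dissipation n)"
proof -
  let ?f = "\<lambda>m. Hh_norm x (F0 m) * sqrt (step t m)" and ?d = "\<lambda>m. CC (D m) * sqrt (step t m)"
  have \<tau>: "step t m \<ge> 0" if "m \<in> {1..n}" for m using time_step[of m] that by simp
  have "(\<Sum>m=1..n. Hh_inner x (F0 m) (D m) * step t m) \<le> (\<Sum>m=1..n. K * (?f m * ?d m))"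
  proof (rule sum_mono)
    fix m assume m: "m \<in> {1..n}"
    have "Hh_inner x (F0 m) (D m) * step t m \<le> K * (Hh_norm x (F0 m) * CC (D m)) * step t m"
      using test[of m] \<tau>[OF m] m by (intro mult_right_mono) auto
    also have "\<dots> = K * (Hh_norm x (F0 m) * CC (D m)) * (sqrt (step t m) * sqrt (step t m))"
      using \<tau>[OF m] by simp
    finally show "Hh_inner x (F0 m) (D m) * step t m \<le> K * (?f m * ?d m)"
      by (simp only: mult_ac)
  qed
  also have "\<dots> = K * (\<Sum>m=1..n. ?f m * ?d m)" by (simp add: sum_distrib_left)
  also have "\<dots> \<le> K * (sqrt (\<Sum>m=1..n. (?f m)\<^sup>2) * sqrt (\<Sum>m=1..n. (?d m)\<^sup>2))"
  proof (rule mult_left_mono[OF _ K])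
    have "(\<Sum>m=1..n. ?f m * ?d m) \<le> (\<Sum>m=1..n. \<bar>?f m\<bar> * \<bar>?d m\<bar>)"
      by (intro sum_mono) (simp flip: abs_mult)
    also have "\<dots> \<le> L2_set ?f {1..n} * L2_set ?d {1..n}" by (rule L2_set_mult_ineq)
    finally show "(\<Sum>m=1..n. ?f m * ?d m) \<le> sqrt (\<Sum>m=1..n. (?f m)\<^sup>2) * sqrt (\<Sum>m=1..n. (?d m)\<^sup>2)"
      by (simp add: L2_set_def)
  qed
  also have "(\<Sum>m=1..n. (?f m)\<^sup>2) = (\<Sum>m=1..n. (Hh_norm x (F0 m))\<^sup>2 * step t m)"
    using \<tau> by (intro sum.cong) (auto simp: power_mult_distrib)
  also have "(\<Sum>m=1..n. (?d m)\<^sup>2) = (\<Sum>m=1..n. (CC (D m))\<^sup>2 * step t m)"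
    using \<tau> by (intro sum.cong) (auto simp: power_mult_distrib)
  also have "K * (sqrt (\<Sum>m=1..n. (Hh_norm x (F0 m))\<^sup>2 * step t m) * sqrt (\<Sum>m=1..n. (CC (D m))\<^sup>2 * step t m))
      \<le> K * (sqrt (\<Sum>m=1..n. (Hh_norm x (F0 m))\<^sup>2 * step t m) * sqrt (dissipation n))"
  proof -
    have "(\<Sum>m=1..n. (CC (D m))\<^sup>2 * step t m) \<le> dissipation n"
      unfolding dissipation_def using sum_nonneg[of "{1..n}", OF dissipation_terms_nonneg(1)] by simp
    then show ?thesis
      using K \<tau> by (intro mult_left_mono real_sqrt_le_mono) (auto intro!: sum_nonneg)
  qed
  finally show ?thesis by (simp add: mult.assoc)
qed

text \<open>
  The energy balance contains products of the data with \<open>|U m|\<close> and with the root of the dissipation. Estimating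
  both by the common maximum \<open>Y\<close> leaves a single quadratic inequality in \<open>Y\<close>.
\<close>

theorem energy_bound:
  assumes K: "K \<ge> 0"
    and test: "\<And>m. m \<ge> 1 \<Longrightarrow> Hh_inner x (F0 m) (D m) \<le> K * (Hh_norm x (F0 m) * CC (D m))"
  shows "max (Max ((\<lambda>m. LL (U m)) ` {0..M})) (sqrt 2 * norm2 x t \<sigma> \<theta> \<rho>h bh ch M U)
    \<le> LL (U 0) + sqrt 2 * K * sqrt (\<Sum>m=1..M. (Hh_norm x (F0 m))\<^sup>2 * step t m)
      + 4 / sqrt \<nu> * (Htilde_norm x (F1 0) + (\<Sum>m=1..M. Htilde_norm x (bdt t F1 m) * step t m))"
proof -
  define y where "y = Max ((\<lambda>m. LL (U m)) ` {0..M})"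
  define z where "z n = sqrt 2 * sqrt (dissipation n)" for n
  define a where "a = sqrt 2 * K * sqrt (\<Sum>m=1..M. (Hh_norm x (F0 m))\<^sup>2 * step t m)"
  define g where "g = 4 / sqrt \<nu> * flux_bound M"
  define Y where "Y = max y (z M)"
  have y_ge: "LL (U m) \<le> y" if "m \<le> M" for m
    using that by (auto simp: y_def intro!: Max_ge)
  have e: "0 \<le> LL (U 0)" "LL (U 0) \<le> Y"
    using L_norm_nonneg[OF U] y_ge[of 0] by (auto simp: Y_def)
  have Y0: "0 \<le> Y" using e by linarith
  have a0: "0 \<le> a"
    using K time_step unfolding a_def by (intro mult_nonneg_nonneg) (auto intro!: sum_nonneg simp: less_imp_le)
  have g0: "0 \<le> g"
    using Htilde_norm_nonneg[OF F1, of M] F1_norm_le[of M] \<nu> unfolding g_def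
    by (intro mult_nonneg_nonneg) auto
  have diss0: "0 \<le> dissipation n" for n
    using dissipation_mono[of 0 n] by (simp add: dissipation_def)
  have level: "(LL (U n))\<^sup>2 + (z n)\<^sup>2 \<le> (LL (U 0))\<^sup>2 + (a + g) * Y" if n: "n \<le> M" for n
  proof -
    have "2 * (\<Sum>m=1..n. Hh_inner x (F0 m) (D m) * step t m)
        \<le> 2 * (K * sqrt (\<Sum>m=1..n. (Hh_norm x (F0 m))\<^sup>2 * step t m) * sqrt (dissipation n))"
      by (intro mult_left_mono source_estimate K test) auto
    also have "\<dots> \<le> 2 * (K * sqrt (\<Sum>m=1..M. (Hh_norm x (F0 m))\<^sup>2 * step t m) * sqrt (dissipation n))"
      using n K diss0 time_step
      by (intro mult_left_mono mult_right_mono real_sqrt_le_mono sum_mono2) (auto simp: less_imp_le)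
    also have "\<dots> = a * z n"
    proof -
      have "2 * (k * s * d) = sqrt 2 * k * s * (sqrt 2 * d)" for k s d :: real
        using real_sqrt_mult_self[of 2] by (metis abs_numeral mult.assoc mult.left_commute)
      then show ?thesis by (simp add: a_def z_def)
    qed
    also have "\<dots> \<le> a * Y"
      using dissipation_mono[OF n] a0 by (intro mult_left_mono) (auto simp: z_def Y_def le_max_iff_disj)
    finally have source: "2 * (\<Sum>m=1..n. Hh_inner x (F0 m) (D m) * step t m) \<le> a * Y" .
    have "- 2 * (\<Sum>m=1..n. Htilde_inner x (F1 m) (bdx x (D m)) * step t m)
        \<le> 4 / sqrt \<nu> * flux_bound n * Y"
      by (rule flux_estimate) (use n y_ge Y_def in \<open>fastforce simp: le_max_iff_disj\<close>)
    also have "\<dots> \<le> g * Y"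
      using flux_bound_mono[OF n] \<nu> Y0 unfolding g_def by (intro mult_right_mono mult_left_mono) auto
    finally have flux: "- 2 * (\<Sum>m=1..n. Htilde_inner x (F1 m) (bdx x (D m)) * step t m) \<le> g * Y" .
    have "(z n)\<^sup>2 = 2 * dissipation n"
      using diss0[of n] by (simp add: z_def power_mult_distrib)
    then show ?thesis
      using energy_balance[of n] source flux by (simp add: distrib_right)
  qed
  \<comment> \<open>The balance is read off at the level where \<open>Y\<close> is attained, dropping the other square.\<close>
  have "Y\<^sup>2 \<le> (LL (U 0))\<^sup>2 + (a + g) * Y"
  proof (cases "z M \<le> y")
    case True
    have "y \<in> (\<lambda>m. LL (U m)) ` {0..M}" unfolding y_def by (intro Max_in) auto
    then obtain n where "n \<le> M" "y = LL (U n)" by auto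
    then have "(LL (U n))\<^sup>2 \<le> (LL (U 0))\<^sup>2 + (a + g) * Y"
      using level[of n] zero_le_power2[of "z n"] by linarith
    then show ?thesis using True \<open>y = LL (U n)\<close> by (simp add: Y_def max_def)
  next
    case False
    have "(z M)\<^sup>2 \<le> (LL (U 0))\<^sup>2 + (a + g) * Y"
      using level[of M] zero_le_power2[of "LL (U M)"] by linarith
    then show ?thesis using False by (simp add: Y_def max_def)
  qed
  \<comment> \<open>One factor \<open>LL (U 0)\<close> is replaced by \<open>Y\<close>, after which \<open>Y\<close> cancels.\<close>
  also have "\<dots> \<le> (LL (U 0) + a + g) * Y"
    using mult_left_mono[OF e(2,1)] by (simp add: power2_eq_square algebra_simps)
  finally have "Y * Y \<le> (LL (U 0) + a + g) * Y" by (simp add: power2_eq_square)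
  then have "Y \<le> LL (U 0) + a + g"
    using e a0 g0 Y0 by (cases "Y = 0") (auto simp: mult_le_cancel_right)
  then show ?thesis
    by (simp add: Y_def y_def z_def a_def g_def flux_bound_def norm2_def dissipation_def)
qed

end

section \<open>The mesh of the half-line\<close>

lemma Bseq_eventually_const:
  fixes f :: "nat \<Rightarrow> real"
  assumes "\<And>j. j \<ge> J \<Longrightarrow> f j = l" shows "Bseq f"
proof -
  have "f \<longlonglongrightarrow> l"
    by (rule tendsto_eventually) (auto simp: eventually_sequentially intro!: exI[of _ J] assms)
  then show ?thesis by (intro convergent_imp_Bseq) (auto simp: convergent_def)
qed

theorem proposition4:
  fixes \<rho> b c :: "real \<Rightarrow> real"
    and \<rho>low \<nu> \<rho>inf binf cinf X0 X \<sigma> \<theta> :: real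
    and x t :: "nat \<Rightarrow> real"
    and J M :: nat
    and \<rho>h bh ch Uh0 :: "nat \<Rightarrow> real"
    and F F0 F1 U :: "nat \<Rightarrow> nat \<Rightarrow> real"
  assumes cont: "continuous_on {0<..} \<rho>" "continuous_on {0<..} b" "continuous_on {0<..} c"
    and lower_pos: "\<rho>low > 0" "\<nu> > 0"
    and lower: "\<And>s. s > 0 \<Longrightarrow> \<rho> s \<ge> \<rho>low" "\<And>s. s > 0 \<Longrightarrow> b s \<ge> \<nu>" "\<And>s. s > 0 \<Longrightarrow> c s \<ge> 0"
    and X0: "X0 > 0"
    and limits: "\<rho>inf > 0" "binf > 0" "cinf \<ge> 0"
    and const: "\<And>s. s \<ge> X0 \<Longrightarrow> \<rho> s = \<rho>inf" "\<And>s. s \<ge> X0 \<Longrightarrow> b s = binf"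
      "\<And>s. s \<ge> X0 \<Longrightarrow> c s = cinf"
    and X: "X > X0"
    and mesh: "x 0 = 0" "strict_mono x" "x J = X" "step x J \<le> X - X0"
      "\<And>j. j \<ge> J \<Longrightarrow> step x j = step x J"
    and time: "t 0 = 0" "strict_mono t" "filterlim t at_top sequentially"
    and mesh_coeffs: "\<rho>h = mesh_coeff x \<rho>" "bh = mesh_coeff x b" "ch = mesh_coeff x c"
    and F_decomp: "\<And>m j. m \<ge> 1 \<Longrightarrow> j \<ge> 1 \<Longrightarrow> F m j = F0 m j + hdx x (F1 m) j"
    and F0: "\<And>m. m \<ge> 1 \<Longrightarrow> F0 m \<in> Hh"
    and F1: "\<And>m. F1 m \<in> Htilde"
    and Uh0: "Uh0 \<in> Hh"
    and sol: "scheme_solution x t \<sigma> \<theta> \<rho>h bh ch F Uh0 U"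
    and U_Hh: "\<And>m. U m \<in> Hh"
    and \<sigma>: "\<sigma> \<ge> 1/2"
    and M: "M \<ge> 1"
  shows "(\<theta> < 1/4 \<longrightarrow>
      max (Max ((\<lambda>m. L_norm x \<theta> bh ch (U m)) ` {0..M})) (sqrt 2 * norm2 x t \<sigma> \<theta> \<rho>h bh ch M U)
      \<le> L_norm x \<theta> bh ch Uh0
        + sqrt (2 / (c_theta \<theta> * \<rho>low)) * sqrt (\<Sum>m=1..M. (Hh_norm x (F0 m))\<^sup>2 * step t m)
        + 4 / sqrt \<nu> * (Htilde_norm x (F1 0) + (\<Sum>m=1..M. Htilde_norm x (bdt t F1 m) * step t m)))
    \<and> (\<theta> = 1/4 \<and> (\<forall>m\<ge>1. \<forall>j. F0 m j = 0) \<longrightarrow>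
      max (Max ((\<lambda>m. L_norm x \<theta> bh ch (U m)) ` {0..M})) (sqrt 2 * norm2 x t \<sigma> \<theta> \<rho>h bh ch M U)
      \<le> L_norm x \<theta> bh ch Uh0
        + 4 / sqrt \<nu> * (Htilde_norm x (F1 0) + (\<Sum>m=1..M. Htilde_norm x (bdt t F1 m) * step t m)))"
proof -
  have x_less: "x i < x j" if "i < j" for i j
    using mesh(2) that by (simp add: strict_mono_def)
  have step_pos: "step x (Suc j) > 0" for j
    using x_less[of j "Suc j"] by (simp add: step_def)
  have J: "J \<ge> 1"
    using mesh(1,3) X X0 by (cases J) auto
  have mid_pos: "(x j + x (Suc j)) / 2 > 0" for j
    using x_less[of 0 "Suc j"] x_less[of 0 j] mesh(1) by (cases j) auto
  \<comment> \<open>As the step at \<open>J\<close> is at most \<open>X - X0\<close>, the node before \<open>X\<close> is not below \<open>X0\<close>, so all mesh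
    coefficients are constant from index \<open>J\<close> on.\<close>
  have mid_ge: "(x (j - 1) + x j) / 2 \<ge> X0" if "j \<ge> J" for j
  proof -
    have mono: "x i \<le> x k" if "i \<le> k" for i k
      using mesh(2) that by (simp add: strict_mono_less_eq)
    have "x (J - 1) \<ge> X0" using mesh(3,4) by (simp add: step_def)
    moreover have "x (J - 1) \<le> x (j - 1)" "x (J - 1) \<le> x j"
      using that by (auto intro!: mono)
    ultimately show ?thesis by simp
  qed
  have bounded: "Bseq \<rho>h" "Bseq bh" "Bseq ch"
    using const mid_ge unfolding mesh_coeffs
    by (auto simp: mesh_coeff_def intro!: Bseq_eventually_const[of J])
  have coeff: "\<rho>h (Suc j) \<ge> \<rho>low" "bh (Suc j) \<ge> \<nu>" "ch (Suc j) \<ge> 0" for j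
    using lower mid_pos[of j] by (simp_all add: mesh_coeffs mesh_coeff_def)
  have scheme_eq: "C_op x \<theta> \<rho>h (bdt t U m) j + A_op x \<theta> bh ch (t_weighted \<sigma> U m) j = F m j"
    if "m \<ge> 1" "j \<ge> 1" for m j
    using sol that by (simp add: scheme_solution_def)
  have U_eq: "U 0 = Uh0" using sol by (auto simp: scheme_solution_def)
  have scheme: "scheme x t \<sigma> \<theta> \<nu> \<rho>h bh ch F0 F1 U" if \<theta>: "\<theta> \<le> 1/4"
  proof
    show "Bseq (step x)" "Bseq (\<lambda>j. inverse (step x j))"
      by (rule Bseq_eventually_const[of J], erule mesh(5),
          rule Bseq_eventually_const[of J], erule arg_cong[OF mesh(5)])
    show "\<rho>h (Suc j) \<ge> 0" for j using coeff(1)[of j] lower_pos by linarith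
    show "step t m > 0" if "m \<ge> 1" for m
      using time(2) that by (simp add: step_def strict_mono_def)
    show "C_op x \<theta> \<rho>h (bdt t U m) j + A_op x \<theta> bh ch (t_weighted \<sigma> U m) j = F0 m j + hdx x (F1 m) j"
      if "m \<ge> 1" "j \<ge> 1" for m j
      using scheme_eq[OF that] F_decomp[OF that] by simp
  qed (use step_pos bounded coeff lower_pos \<theta> \<sigma> F0 F1 U_Hh in auto)
  show ?thesis
  proof (intro conjI impI)
    assume theta_less: "\<theta> < 1/4"
    interpret scheme x t \<sigma> \<theta> \<nu> \<rho>h bh ch F0 F1 U by (rule scheme) (use theta_less in simp)
    have c: "c_theta \<theta> * \<rho>low > 0" using theta_less lower_pos by (auto simp: c_theta_def max_def)
    define K where "K = 1 / sqrt (c_theta \<theta> * \<rho>low)"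
    have "Hh_inner x (F0 m) (D m) \<le> K * (Hh_norm x (F0 m) * CC (D m))" if "m \<ge> 1" for m
    proof -
      have "sqrt (c_theta \<theta> * \<rho>low) * Hh_norm x (D m) = sqrt (c_theta \<theta> * \<rho>low * (Hh_norm x (D m))\<^sup>2)"
        using Hh_inner_nonneg[OF D_Hh] by (simp add: real_sqrt_mult Hh_norm_def)
      also have "\<dots> \<le> CC (D m)"
        unfolding C_norm_def using C_form_coercive[OF bounded(1) coeff(1) _ _ D_Hh] lower_pos \<theta>
        by (intro real_sqrt_le_mono) auto
      finally have "Hh_norm x (D m) \<le> K * CC (D m)" using c by (simp add: K_def field_simps)
      then have "Hh_norm x (F0 m) * Hh_norm x (D m) \<le> Hh_norm x (F0 m) * (K * CC (D m))"
        using Hh_inner_nonneg[OF F0[OF that]] by (intro mult_left_mono) (auto simp: Hh_norm_def)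
      then show ?thesis using Hh_Cauchy_Schwarz[OF F0[OF that] D_Hh, of m] by (simp add: mult_ac)
    qed
    moreover have "sqrt 2 * K = sqrt (2 / (c_theta \<theta> * \<rho>low))" "K \<ge> 0"
      using c by (simp_all add: K_def real_sqrt_divide)
    ultimately show "max (Max ((\<lambda>m. L_norm x \<theta> bh ch (U m)) ` {0..M})) (sqrt 2 * norm2 x t \<sigma> \<theta> \<rho>h bh ch M U)
      \<le> L_norm x \<theta> bh ch Uh0
        + sqrt (2 / (c_theta \<theta> * \<rho>low)) * sqrt (\<Sum>m=1..M. (Hh_norm x (F0 m))\<^sup>2 * step t m)
        + 4 / sqrt \<nu> * (Htilde_norm x (F1 0) + (\<Sum>m=1..M. Htilde_norm x (bdt t F1 m) * step t m))"
      using energy_bound[of K M] U_eq by simp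
  next
    assume *: "\<theta> = 1/4 \<and> (\<forall>m\<ge>1. \<forall>j. F0 m j = 0)"
    interpret scheme x t \<sigma> \<theta> \<nu> \<rho>h bh ch F0 F1 U by (rule scheme) (use * in simp)
    have "Hh_inner x (F0 m) (D m) \<le> 0 * (Hh_norm x (F0 m) * CC (D m))" if "m \<ge> 1" for m
      using * that by (simp add: Hh_inner_def)
    then show "max (Max ((\<lambda>m. L_norm x \<theta> bh ch (U m)) ` {0..M})) (sqrt 2 * norm2 x t \<sigma> \<theta> \<rho>h bh ch M U)
      \<le> L_norm x \<theta> bh ch Uh0
        + 4 / sqrt \<nu> * (Htilde_norm x (F1 0) + (\<Sum>m=1..M. Htilde_norm x (bdt t F1 m) * step t m))"
      using energy_bound[of 0 M] U_eq by simp
  qed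
qed

end
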